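(* Let $K$ be a unital commutative ring, let $R$ be a unital $K$-algebra, and let $$f=\sum_{\sigma\in\mathrm{Sym}(m)}\lambda_\sigma x_{\sigma(1)}\cdots x_{\sigma(m)}\in K\langle\mathcal X\rangle\quad\text{with}\quad \sum_{\sigma\in\mathrm{Sym}(m)}\lambda_\sigma=0.$$ If $R=(f(R)^n)^+$, where $n>1$ is a positive integer, then there exists $N\in\mathbb N$ such that every $x\in R$ can be written as $x=a_1+\cdots+a_N$ for some $a_i\in f(R)^{[n]}$.
   Context: Algebras are associative. $K\langle\mathcal X\rangle$ is the free associative $K$-algebra on noncommuting variables $x_1,x_2,\dots$; $\mathrm{Sym}(m)$ is the symmetric group on $\{1,\dots,m\}$, $m\geq 1$. $f(R)=\{f(a_1,\dots,a_m)\mid a_i\in R\}$. $f(R)^{[n]}=\{y_1y_2\cdots y_n\mid y_i\in f(R)\}$, and $(f(R)^n)^+$ is the additive subgroup of $R$ generated by $f(R)^{[n]}$. *)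

theory Defs
  imports
    Complex_Main
    "HOL-Library.Poly_Mapping"
    "HOL-Combinatorics.Permutations"
    "HOL-Computational_Algebra.Group_Closure"
begin

text \<open>
  An associative unital algebra \<open>R\<close> (the type \<open>'r\<close>) over a commutative unital ring \<open>K\<close> (the
  type \<open>'k\<close>).  The sorts are deliberately weaker than \<^class>\<open>ring_1\<close> and
  \<^class>\<open>comm_ring_1\<close>, which would exclude the zero ring; this is also why the module axioms are
  spelled out instead of taken from the locale \<^locale>\<open>module\<close>.
\<close>

locale unital_algebra =
  fixes scale :: "'k::{comm_ring,comm_monoid_mult} \<Rightarrow> 'r::{ring,monoid_mult} \<Rightarrow> 'r"
  assumes scale_add_right: "scale c (x + y) = scale c x + scale c y"
    and scale_add_left: "scale (c + d) x = scale c x + scale d x"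
    and scale_scale: "scale c (scale d x) = scale (c * d) x"
    and scale_one: "scale 1 x = x"
    and scale_mult_left: "scale c x * y = scale c (x * y)"
    and scale_mult_right: "x * scale c y = scale c (x * y)"

text \<open>
  Elements of the free algebra \<open>K\<langle>x\<^sub>1, x\<^sub>2, \<dots>\<rangle>\<close> are finitely supported functions from words
  to coefficients; the list \<open>[i\<^sub>1, \<dots>, i\<^sub>r]\<close> stands for the monomial
  \<open>x\<^bsub>i\<^sub>1\<^esub> \<cdots> x\<^bsub>i\<^sub>r\<^esub>\<close>.
\<close>

type_synonym 'k ncpoly = "nat list \<Rightarrow>\<^sub>0 'k"

definition nc_eval ::
  "('k::{comm_ring,comm_monoid_mult} \<Rightarrow> 'r::{ring,monoid_mult} \<Rightarrow> 'r) \<Rightarrow> 'k ncpoly \<Rightarrow> (nat \<Rightarrow> 'r) \<Rightarrow> 'r"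
  where "nc_eval scale f a =
    (\<Sum>w\<in>Poly_Mapping.keys f. scale (Poly_Mapping.lookup f w) (prod_list (map a w)))"

definition nc_image ::
  "('k::{comm_ring,comm_monoid_mult} \<Rightarrow> 'r::{ring,monoid_mult} \<Rightarrow> 'r) \<Rightarrow> 'k ncpoly \<Rightarrow> 'r set"
  where "nc_image scale f = range (nc_eval scale f)"

definition multilinear_ncpoly ::
  "nat \<Rightarrow> ((nat \<Rightarrow> nat) \<Rightarrow> 'k::{comm_ring,comm_monoid_mult}) \<Rightarrow> 'k ncpoly"
  where "multilinear_ncpoly m lam =
    (\<Sum>\<sigma> | \<sigma> permutes {1..m}. Poly_Mapping.single (map \<sigma> [1..<Suc m]) (lam \<sigma>))"

definition n_products :: "'r::monoid_mult set \<Rightarrow> nat \<Rightarrow> 'r set"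
  where "n_products S n = {prod_list ys | ys. length ys = n \<and> set ys \<subseteq> S}"

end

theory Submission
  imports Defs
begin

text \<open>
  Write \<open>F = f(R)\<close> and \<open>[x, y] = x y - y x\<close>.  Since \<open>[x, _]\<close> is a derivation, \<open>[x, f(a)]\<close> is the
  sum of the \<open>m\<close> values \<open>f(\<dots>, [x, a\<^sub>i], \<dots>)\<close>.  Hence for every fixed \<open>p\<close> the elements \<open>[x, p]\<close> are
  sums of boundedly many elements of \<open>F\<^bsup>[n]\<^esup>\<close>, uniformly in \<open>x\<close>.  The set \<open>J\<close> of those \<open>z\<close> for which
  all \<open>z x\<close> are such sums, uniformly in \<open>x\<close>, is therefore a two-sided ideal, because
  \<open>r z x = [r, z x] + z x r\<close>; it contains \<open>[a, b]\<close> for \<open>a \<in> F\<close>, \<open>b \<in> F\<^bsup>[n-1]\<^esup>\<close>,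
  because \<open>[a, b] x = [a, b x] - b [a, x]\<close>.  Modulo \<open>J\<close> the elements of \<open>F\<^bsup>[n-1]\<^esup>\<close> are thus central;
  as \<open>1\<close> is a sum of products \<open>a b\<close> of this kind, so are those of \<open>F\<^bsup>[j]\<^esup>\<close> for \<open>j = n-2, \<dots>, 1\<close>.
  So \<open>R/J\<close> is commutative, \<open>f\<close> vanishes on it since its coefficients sum to zero, and \<open>J = R\<close>.
\<close>

section \<open>Products of elements of a set\<close>

abbreviation commutator :: "'a::ring \<Rightarrow> 'a \<Rightarrow> 'a"
  where "commutator x y \<equiv> x * y - y * x"

lemma n_products_Cons: "y \<in> S \<Longrightarrow> p \<in> n_products S k \<Longrightarrow> y * p \<in> n_products S (Suc k)"
  by (force simp: n_products_def intro: exI[of _ "_ # _"])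

lemma n_products_snoc:
  assumes "p \<in> n_products S k" "y \<in> S" shows "p * y \<in> n_products S (Suc k)"
proof -
  from assms(1) obtain ys where "p = prod_list ys" "length ys = k" "set ys \<subseteq> S"
    by (auto simp: n_products_def)
  with assms(2) show ?thesis
    by (auto simp: n_products_def intro!: exI[of _ "ys @ [y]"])
qed

lemma n_products_SucE:
  assumes "p \<in> n_products S (Suc k)"
  obtains y q where "p = y * q" "y \<in> S" "q \<in> n_products S k"
  using assms by (fastforce simp: n_products_def length_Suc_conv)

lemma n_products_0 [simp]: "n_products S 0 = {1}"
  by (auto simp: n_products_def)

lemma n_products_1 [simp]: "n_products S (Suc 0) = S"
  by (force simp: n_products_def length_Suc_conv)

text \<open>Serves, together with \<open>group_closure_subset_closed\<close>, to show that a unital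
  subring containing \<open>F\<close> is the whole ring once the products of elements of
  \<open>F\<close> generate it additively.\<close>

lemma n_products_subset_closed:
  assumes "1 \<in> T" "\<And>x y. x \<in> T \<Longrightarrow> y \<in> T \<Longrightarrow> x * y \<in> T" "S \<subseteq> T"
  shows "n_products S k \<subseteq> T"
proof (induction k)
  case (Suc k)
  then show ?case using assms by (auto elim!: n_products_SucE)
qed (simp add: assms)

lemma group_closure_subset_closed:
  assumes "0 \<in> T" "\<And>x y. x \<in> T \<Longrightarrow> y \<in> T \<Longrightarrow> x - y \<in> T" "S \<subseteq> T"
  shows "group_closure S \<subseteq> T"
proof
  fix x assume "x \<in> group_closure S"
  then show "x \<in> T" by induction (use assms in auto)
qed

section \<open>Functions with values in bounded sums\<close>

text \<open>\<open>N\<close> is fixed before \<open>x\<close>, which is the uniformity the theorem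
  asks for. Exactly \<open>N\<close> summands, rather than at most \<open>N\<close>, let bounds add
  up without padding by zeros; the free domain type allows substitution in the argument.\<close>

definition bounded_sums :: "'r::ab_group_add set \<Rightarrow> ('a \<Rightarrow> 'r) \<Rightarrow> bool"
  where "bounded_sums S g \<longleftrightarrow>
    (\<exists>N. \<forall>x. \<exists>ys. length ys = N \<and> set ys \<subseteq> S \<and> g x = sum_list ys)"

lemma bounded_sums_zero: "bounded_sums S (\<lambda>_. 0)"
  unfolding bounded_sums_def by (intro exI[of _ 0]) auto

lemma bounded_sums_member: "(\<And>x. g x \<in> S) \<Longrightarrow> bounded_sums S g"
  unfolding bounded_sums_def by (intro exI[of _ 1] allI, rule_tac x = "[g x]" in exI) auto

lemma bounded_sums_add:
  assumes "bounded_sums S g" "bounded_sums S h"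
  shows "bounded_sums S (\<lambda>x. g x + h x)"
proof -
  from assms obtain M N where
    M: "\<And>x. \<exists>ys. length ys = M \<and> set ys \<subseteq> S \<and> g x = sum_list ys" and
    N: "\<And>x. \<exists>ys. length ys = N \<and> set ys \<subseteq> S \<and> h x = sum_list ys"
    unfolding bounded_sums_def by blast
  have "\<exists>ys. length ys = M + N \<and> set ys \<subseteq> S \<and> g x + h x = sum_list ys" for x
  proof -
    from M[of x] N[of x] obtain ys zs where
      "length ys = M" "set ys \<subseteq> S" "g x = sum_list ys"
      "length zs = N" "set zs \<subseteq> S" "h x = sum_list zs" by blast
    then show ?thesis by (intro exI[of _ "ys @ zs"]) auto
  qed
  then show ?thesis unfolding bounded_sums_def by blast
qed

lemma bounded_sums_sum:
  "(\<And>i. i \<in> A \<Longrightarrow> bounded_sums S (g i)) \<Longrightarrow> bounded_sums S (\<lambda>x. \<Sum>i\<in>A. g i x)"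
  by (induction A rule: infinite_finite_induct)
    (simp_all add: bounded_sums_zero bounded_sums_add)

lemma bounded_sums_comp: "bounded_sums S g \<Longrightarrow> bounded_sums S (\<lambda>x. g (h x))"
  unfolding bounded_sums_def by meson

text \<open>An additive \<open>h\<close> acts on the summands one by one and so keeps their number.
  It is applied to negation and to multiplication by a fixed element on either side.\<close>

lemma bounded_sums_image:
  assumes "bounded_sums S g" "\<And>s. s \<in> S \<Longrightarrow> h s \<in> T"
    and h: "h 0 = 0" "\<And>x y. h (x + y) = h x + h y"
  shows "bounded_sums T (\<lambda>x. h (g x))"
proof -
  have hs: "h (sum_list ys) = sum_list (map h ys)" for ys
    by (induction ys) (auto simp: h)
  from assms(1) obtain N where
    N: "\<And>x. \<exists>ys. length ys = N \<and> set ys \<subseteq> S \<and> g x = sum_list ys"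
    unfolding bounded_sums_def by blast
  have "\<exists>ys. length ys = N \<and> set ys \<subseteq> T \<and> h (g x) = sum_list ys" for x
  proof -
    from N[of x] obtain ys where "length ys = N" "set ys \<subseteq> S" "g x = sum_list ys" by blast
    then show ?thesis using assms(2) by (intro exI[of _ "map h ys"]) (auto simp: hs)
  qed
  then show ?thesis unfolding bounded_sums_def by blast
qed

lemma bounded_sums_minus:
  assumes "bounded_sums S g" "bounded_sums S h" "\<And>s. s \<in> S \<Longrightarrow> - s \<in> S"
  shows "bounded_sums S (\<lambda>x. g x - h x)"
proof -
  have "bounded_sums S (\<lambda>x. - h x)"
    by (rule bounded_sums_image[OF assms(2)]) (use assms(3) in auto)
  from bounded_sums_add[OF assms(1) this] show ?thesis by simp
qed

text \<open>By the Leibniz rule only one factor at a time is replaced by elements of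
  \<open>F\<close>, so the products keep their length \<open>k\<close>.\<close>

lemma bounded_sums_commutator_n_products:
  assumes F: "\<And>y. y \<in> F \<Longrightarrow> bounded_sums F (\<lambda>x. commutator x y)"
    and p: "p \<in> n_products F k"
  shows "bounded_sums (n_products F k) (\<lambda>x::'r::{ring,monoid_mult}. commutator x p)"
  using p
proof (induction k arbitrary: p)
  case 0
  then show ?case by (simp add: bounded_sums_zero)
next
  case (Suc k)
  then obtain y q where p: "p = y * q" and y: "y \<in> F" and q: "q \<in> n_products F k"
    by (auto elim: n_products_SucE)
  have "bounded_sums (n_products F (Suc k)) (\<lambda>x. commutator x y * q)"
    by (rule bounded_sums_image[OF F[OF y]])
      (use q n_products_Cons in \<open>auto simp: algebra_simps\<close>)
  moreover have "bounded_sums (n_products F (Suc k)) (\<lambda>x. y * commutator x q)"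
    by (rule bounded_sums_image[OF Suc.IH[OF q]])
      (use y n_products_Cons in \<open>auto simp: algebra_simps\<close>)
  moreover have "commutator x p = commutator x y * q + y * commutator x q" for x
    by (simp add: p algebra_simps)
  ultimately show ?case by (simp add: bounded_sums_add)
qed

text \<open>The bound may depend on \<open>p\<close>: the elements \<open>p\<close> that admit some
  bound form an additive subgroup, and it contains the generators \<open>B\<close>.\<close>

lemma bounded_sums_commutator:
  assumes "group_closure B = UNIV" "\<And>b. b \<in> B \<Longrightarrow> bounded_sums B (\<lambda>x. commutator x b)"
    and "\<And>b. b \<in> B \<Longrightarrow> - b \<in> B"
  shows "bounded_sums B (\<lambda>x::'r::{ring,monoid_mult}. commutator x p)"
proof -
  have "group_closure B \<subseteq> {p. bounded_sums B (\<lambda>x. commutator x p)}"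
  proof (rule group_closure_subset_closed)
    fix p q assume "p \<in> {p. bounded_sums B (\<lambda>x. commutator x p)}"
      "q \<in> {p. bounded_sums B (\<lambda>x. commutator x p)}"
    then have "bounded_sums B (\<lambda>x. commutator x p - commutator x q)"
      using bounded_sums_minus assms(3) by blast
    moreover have "commutator x p - commutator x q = commutator x (p - q)" for x
      by (simp add: algebra_simps)
    ultimately show "p - q \<in> {p. bounded_sums B (\<lambda>x. commutator x p)}" by simp
  qed (use assms(2) in \<open>auto simp: bounded_sums_zero\<close>)
  then show ?thesis using assms(1) by auto
qed

section \<open>Commutativity modulo an ideal\<close>

locale two_sided_ideal =
  fixes J :: "'r::{ring,monoid_mult} set"
  assumes zero: "0 \<in> J"
    and diff: "x \<in> J \<Longrightarrow> y \<in> J \<Longrightarrow> x - y \<in> J"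
    and mult_left: "x \<in> J \<Longrightarrow> r * x \<in> J"
    and mult_right: "x \<in> J \<Longrightarrow> x * r \<in> J"
begin

lemma add: "x \<in> J \<Longrightarrow> y \<in> J \<Longrightarrow> x + y \<in> J"
  using diff[of x "0 - y"] diff[OF zero, of y] by simp

lemma sum: "(\<And>i. i \<in> A \<Longrightarrow> g i \<in> J) \<Longrightarrow> (\<Sum>i\<in>A. g i) \<in> J"
  by (induction A rule: infinite_finite_induct) (auto simp: zero add)

lemma commutator_mult_left:
  assumes "commutator x z \<in> J" "commutator y z \<in> J"
  shows "commutator (x * y) z \<in> J"
proof -
  have "commutator (x * y) z = x * commutator y z + commutator x z * y"
    by (simp add: algebra_simps)
  then show ?thesis using assms by (simp add: add mult_left mult_right)
qed

lemma commutator_diff_left: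
  assumes "commutator x z \<in> J" "commutator y z \<in> J"
  shows "commutator (x - y) z \<in> J"
proof -
  have "commutator (x - y) z = commutator x z - commutator y z"
    by (simp add: algebra_simps)
  then show ?thesis using assms by (simp add: diff)
qed

lemma commutators_in_ideal:
  assumes comm: "\<And>a b. a \<in> F \<Longrightarrow> b \<in> n_products F (n - 1) \<Longrightarrow> commutator a b \<in> J"
    and gen: "group_closure (n_products F n) = UNIV" and "n > 1"
  shows "commutator x y \<in> J"
proof -
  \<comment> \<open>\<open>Z\<close> is the preimage of the center of the quotient by
    \<open>J\<close>, hence a unital subring.\<close>
  define Z where "Z = {z. \<forall>y. commutator z y \<in> J}"
  have Z_diff: "x - y \<in> Z" if "x \<in> Z" "y \<in> Z" for x y
    using that commutator_diff_left by (auto simp: Z_def)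
  have Z_mult: "x * y \<in> Z" if "x \<in> Z" "y \<in> Z" for x y
    using that commutator_mult_left by (auto simp: Z_def)
  have Z_0_1: "0 \<in> Z" "1 \<in> Z" by (auto simp: Z_def zero)
  have top: "n_products F (n - 1) \<subseteq> Z"
  proof
    fix b assume b: "b \<in> n_products F (n - 1)"
    \<comment> \<open>The centralizer of \<open>b\<close> modulo \<open>J\<close> is a unital
      subring, and by \<open>comm\<close> it contains \<open>F\<close>.\<close>
    have "group_closure (n_products F n) \<subseteq> {x. commutator x b \<in> J}"
      by (intro group_closure_subset_closed n_products_subset_closed)
        (use b comm commutator_mult_left commutator_diff_left in \<open>auto simp: zero\<close>)
    then have "commutator x b \<in> J" for x using gen by auto
    then have "0 - commutator x b \<in> J" for x using diff zero by blast
    then show "b \<in> Z" by (simp add: Z_def)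
  qed
  have "n_products F (Suc 0) \<subseteq> Z"
  proof (rule inc_induct[of "Suc 0" "n - 1"])
    fix j assume IH: "n_products F (Suc j) \<subseteq> Z"
    show "n_products F j \<subseteq> Z"
    proof
      fix q assume q: "q \<in> n_products F j"
      \<comment> \<open>The induction runs downward from \<open>n - 1\<close> to 1. For a generator
        \<open>a * b\<close>, the product \<open>q * a\<close> has \<open>Suc j\<close> factors and
        lies in \<open>Z\<close> by induction, and \<open>b\<close> lies in \<open>Z\<close> by
        \<open>top\<close>. So \<open>q * x\<close> lies in \<open>Z\<close> for every
        \<open>x\<close>, in particular for \<open>x = 1\<close>.\<close>
      have "group_closure (n_products F n) \<subseteq> {x. q * x \<in> Z}"
      proof (rule group_closure_subset_closed)
        show "n_products F n \<subseteq> {x. q * x \<in> Z}"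
        proof
          fix p assume "p \<in> n_products F n"
          then have "p \<in> n_products F (Suc (n - 1))" using \<open>n > 1\<close> by simp
          then obtain a b where "p = a * b" "a \<in> F" "b \<in> n_products F (n - 1)"
            by (rule n_products_SucE)
          moreover from this have "q * a \<in> Z" "b \<in> Z"
            using n_products_snoc[OF q] IH top by auto
          ultimately show "p \<in> {x. q * x \<in> Z}"
            using Z_mult[of "q * a" b] by (simp add: mult.assoc)
        qed
      qed (use Z_diff Z_0_1 in \<open>auto simp: right_diff_distrib\<close>)
      then have "q * 1 \<in> Z" using gen by blast
      then show "q \<in> Z" by simp
    qed
  qed (use \<open>n > 1\<close> top in auto)
  then have "group_closure (n_products F n) \<subseteq> Z"
    using Z_diff Z_mult Z_0_1
    by (intro group_closure_subset_closed n_products_subset_closed) auto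
  then show ?thesis using gen by (auto simp: Z_def)
qed

text \<open>The head \<open>x\<close> of \<open>xs\<close> is moved to the front of
  \<open>ys\<close> past a prefix \<open>l\<close>, at the cost of one commutator of
  \<open>x\<close> with \<open>prod_list l\<close>, which vanishes modulo \<open>J\<close>.\<close>

lemma prod_list_mset_cong:
  assumes comm: "\<And>x y. commutator x y \<in> J" and "mset xs = mset ys"
  shows "prod_list xs - prod_list ys \<in> J"
  using assms(2)
proof (induction xs arbitrary: ys)
  case Nil
  then show ?case by (simp add: zero)
next
  case (Cons x xs)
  then have "x \<in> set ys" by (metis list.set_intros(1) mset_eq_setD)
  then obtain l r where ys: "ys = l @ x # r" by (meson split_list)
  with Cons.prems have "prod_list xs - prod_list (l @ r) \<in> J" by (intro Cons.IH) simp
  then have "x * (prod_list xs - prod_list (l @ r)) \<in> J" by (rule mult_left)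
  moreover have "commutator x (prod_list l) * prod_list r \<in> J"
    by (rule mult_right) (rule comm)
  moreover have "prod_list (x # xs) - prod_list ys =
      x * (prod_list xs - prod_list (l @ r)) + commutator x (prod_list l) * prod_list r"
    by (simp add: ys algebra_simps)
  ultimately show ?case by (simp only: add)
qed

end

section \<open>Values of multilinear polynomials\<close>

text \<open>Distinctness and membership make the variable \<open>i\<close> occur exactly once in the
  word, so exactly one factor splits.\<close>

lemma prod_list_fun_upd_additive:
  assumes "distinct w" "i \<in> set w"
  shows "prod_list (map (a(i := x + y)) w) =
    prod_list (map (a(i := x)) w) + prod_list (map (a(i := (y::'r::{ring,monoid_mult}))) w)"
  using assms
proof (induction w)
  case (Cons j w)
  show ?case
  proof (cases "i = j")
    case True
    then have "map (a(i := z)) w = map a w" for z using Cons.prems by auto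
    then show ?thesis
      using True by (simp only: list.map prod_list.Cons fun_upd_same distrib_right)
  next
    case False
    then show ?thesis using Cons by (simp add: distrib_left)
  qed
qed simp

text \<open>This is the Leibniz rule for the derivation given by commutation with \<open>x\<close>.
  Each variable occurs once in \<open>w\<close>, so the term in which one factor is differentiated
  is the same word evaluated at a modified assignment.\<close>

lemma commutator_prod_list:
  assumes "distinct w"
  shows "commutator x (prod_list (map a w)) =
    (\<Sum>i\<in>set w. prod_list (map (a(i := commutator x (a i :: 'r::{ring,monoid_mult}))) w))"
  using assms
proof (induction w)
  case (Cons j w)
  define b where "b i = a(i := commutator x (a i))" for i
  have bj: "b i j = (if i = j then commutator x (a j) else a j)" for i
    by (simp add: b_def)
  \<comment> \<open>As \<open>j\<close> does not occur in \<open>w\<close>, the summand for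
    \<open>j\<close> is modified only in its first factor; all other summands keep
    \<open>a j\<close> there.\<close>
  have "map (b j) w = map a w" using Cons.prems by (auto simp: b_def)
  then have "(\<Sum>i\<in>set (j # w). prod_list (map (b i) (j # w))) =
      commutator x (a j) * prod_list (map a w) + (\<Sum>i\<in>set w. b i j * prod_list (map (b i) w))"
    using Cons.prems by (simp add: bj del: map_eq_conv)
  also have "(\<Sum>i\<in>set w. b i j * prod_list (map (b i) w)) =
      a j * (\<Sum>i\<in>set w. prod_list (map (b i) w))"
    unfolding sum_distrib_left by (rule sum.cong) (use Cons.prems in \<open>auto simp: bj\<close>)
  also have "(\<Sum>i\<in>set w. prod_list (map (b i) w)) = commutator x (prod_list (map a w))"
    using Cons by (simp add: b_def del: fun_upd_apply)
  also have "commutator x (a j) * prod_list (map a w) + a j * commutator x (prod_list (map a w)) =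
      commutator x (prod_list (map a (j # w)))"
    by (simp add: algebra_simps)
  finally show ?case by (simp only: b_def)
qed simp

context unital_algebra
begin

lemma scale_zero_left: "scale 0 x = 0"
  using scale_add_left[of 0 0 x] by simp

lemma scale_zero_right: "scale c 0 = 0"
  using scale_add_right[of c 0 0] by simp

lemma scale_minus_right: "scale c (- x) = - scale c x"
  using scale_add_right[of c x "- x"] by (simp add: scale_zero_right eq_neg_iff_add_eq_0 add.commute)

lemma scale_diff_right: "scale c (x - y) = scale c x - scale c y"
  using scale_add_right[of c x "- y"] by (simp add: scale_minus_right)

lemma scale_sum_right: "scale c (\<Sum>i\<in>A. g i) = (\<Sum>i\<in>A. scale c (g i))"
  by (induction A rule: infinite_finite_induct) (auto simp: scale_zero_right scale_add_right)

lemma scale_sum_left: "scale (\<Sum>i\<in>A. g i) x = (\<Sum>i\<in>A. scale (g i) x)"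
  by (induction A rule: infinite_finite_induct) (auto simp: scale_zero_left scale_add_left)

lemma scale_commutator: "commutator x (scale c y) = scale c (commutator x y)"
  by (simp add: scale_diff_right scale_mult_left scale_mult_right)

text \<open>Cancellation can make the support of a sum smaller than the union of the supports; a
  common larger index set lets evaluations be added term by term.\<close>

lemma nc_eval_superset:
  assumes "finite A" "Poly_Mapping.keys f \<subseteq> A"
  shows "nc_eval scale f a = (\<Sum>w\<in>A. scale (Poly_Mapping.lookup f w) (prod_list (map a w)))"
  unfolding nc_eval_def
  by (rule sum.mono_neutral_left) (use assms in \<open>auto simp: in_keys_iff scale_zero_left\<close>)

lemma nc_eval_add: "nc_eval scale (f + g) a = nc_eval scale f a + nc_eval scale g a"
proof -
  let ?A = "Poly_Mapping.keys f \<union> Poly_Mapping.keys g"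
  have "Poly_Mapping.keys (f + g) \<subseteq> ?A" by (rule Poly_Mapping.keys_add)
  then show ?thesis
    by (simp add: nc_eval_superset[of ?A] lookup_add scale_add_left sum.distrib)
qed

lemma nc_eval_single: "nc_eval scale (Poly_Mapping.single w c) a = scale c (prod_list (map a w))"
  by (simp add: nc_eval_superset[of "{w}"])

lemma nc_eval_sum: "nc_eval scale (\<Sum>i\<in>A. g i) a = (\<Sum>i\<in>A. nc_eval scale (g i) a)"
  by (induction A rule: infinite_finite_induct) (simp_all add: nc_eval_add, simp_all add: nc_eval_def)

lemma nc_eval_multilinear:
  "nc_eval scale (multilinear_ncpoly m lam) a =
    (\<Sum>\<sigma> | \<sigma> permutes {1..m}. scale (lam \<sigma>) (prod_list (map a (map \<sigma> [1..<Suc m]))))"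
  by (simp only: multilinear_ncpoly_def nc_eval_sum nc_eval_single)

lemma permuted_word:
  assumes "\<sigma> permutes {1..m}"
  shows "distinct (map \<sigma> [1..<Suc m])" "set (map \<sigma> [1..<Suc m]) = {1..m}"
proof -
  have "set [1..<Suc m] = {1..m}" by auto
  then show "distinct (map \<sigma> [1..<Suc m])" "set (map \<sigma> [1..<Suc m]) = {1..m}"
    using permutes_inj_on[OF assms] permutes_image[OF assms]
    by (simp_all add: distinct_map del: upt_Suc)
qed

lemma nc_eval_multilinear_upd_add:
  assumes "i \<in> {1..m}"
  shows "nc_eval scale (multilinear_ncpoly m lam) (a(i := x + y)) =
    nc_eval scale (multilinear_ncpoly m lam) (a(i := x)) +
    nc_eval scale (multilinear_ncpoly m lam) (a(i := y))"
  unfolding nc_eval_multilinear sum.distrib[symmetric]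
proof (rule sum.cong[OF refl])
  fix \<sigma> assume "\<sigma> \<in> {\<sigma>. \<sigma> permutes {1..m}}"
  then have "distinct (map \<sigma> [1..<Suc m])" "i \<in> set (map \<sigma> [1..<Suc m])"
    using permuted_word[of \<sigma> m] assms by blast+
  from prod_list_fun_upd_additive[OF this, of a x y]
  show "scale (lam \<sigma>) (prod_list (map (a(i := x + y)) (map \<sigma> [1..<Suc m]))) =
    scale (lam \<sigma>) (prod_list (map (a(i := x)) (map \<sigma> [1..<Suc m]))) +
    scale (lam \<sigma>) (prod_list (map (a(i := y)) (map \<sigma> [1..<Suc m])))"
    by (simp only: scale_add_right)
qed

lemma zero_in_nc_image:
  assumes "m \<ge> 1" shows "0 \<in> nc_image scale (multilinear_ncpoly m lam)"
proof -
  \<comment> \<open>The zero assignment is written as an update so that additivity in variable 1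
    applies; it shows that the value equals twice itself.\<close>
  have "nc_eval scale (multilinear_ncpoly m lam) ((\<lambda>_. 0)(1 := 0)) = 0"
    using nc_eval_multilinear_upd_add[of 1 m lam "\<lambda>_. 0" 0 0] assms by simp
  then show ?thesis unfolding nc_image_def by (metis rangeI)
qed

text \<open>By additivity in the first variable, negating its value negates the polynomial. This is
  what later allows bounded sums to be subtracted.\<close>

lemma minus_in_nc_image:
  assumes "m \<ge> 1" "y \<in> nc_image scale (multilinear_ncpoly m lam)"
  shows "- y \<in> nc_image scale (multilinear_ncpoly m lam)"
proof -
  let ?e = "nc_eval scale (multilinear_ncpoly m lam)"
  from assms(2) obtain a where y: "y = ?e a" by (auto simp: nc_image_def)
  have add: "?e (a(1 := u + v)) = ?e (a(1 := u)) + ?e (a(1 := v))" for u v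
    using nc_eval_multilinear_upd_add assms(1) by simp
  have "?e (a(1 := 0)) = 0" using add[of 0 0] by simp
  then have "?e (a(1 := - a 1)) = - y"
    using add[of "a 1" "- a 1"] by (simp add: y eq_neg_iff_add_eq_0 add.commute)
  then show ?thesis unfolding nc_image_def by (metis rangeI)
qed

text \<open>Every word contains each of the variables from 1 to \<open>m\<close> exactly once, so
  the Leibniz sums of all words run over the same index set and the two summations can be
  swapped.\<close>

lemma commutator_nc_eval_multilinear:
  "commutator x (nc_eval scale (multilinear_ncpoly m lam) a) =
    (\<Sum>i\<in>{1..m}. nc_eval scale (multilinear_ncpoly m lam) (a(i := commutator x (a i))))"
proof -
  let ?P = "{\<sigma>. \<sigma> permutes {1..m}}" and ?w = "\<lambda>\<sigma>. map \<sigma> [1..<Suc m]"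
  have "commutator x (nc_eval scale (multilinear_ncpoly m lam) a) =
      (\<Sum>\<sigma>\<in>?P. commutator x (scale (lam \<sigma>) (prod_list (map a (?w \<sigma>)))))"
    unfolding nc_eval_multilinear by (simp only: sum_distrib_left sum_distrib_right sum_subtractf)
  also have "\<dots> = (\<Sum>\<sigma>\<in>?P. \<Sum>i\<in>{1..m}.
      scale (lam \<sigma>) (prod_list (map (a(i := commutator x (a i))) (?w \<sigma>))))"
  proof (rule sum.cong[OF refl])
    fix \<sigma> assume "\<sigma> \<in> ?P"
    then have w: "distinct (?w \<sigma>)" "set (?w \<sigma>) = {1..m}" using permuted_word by blast+
    show "commutator x (scale (lam \<sigma>) (prod_list (map a (?w \<sigma>)))) = (\<Sum>i\<in>{1..m}.
        scale (lam \<sigma>) (prod_list (map (a(i := commutator x (a i))) (?w \<sigma>))))"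
      by (simp only: scale_commutator commutator_prod_list[OF w(1)] w(2) scale_sum_right)
  qed
  also have "\<dots> = (\<Sum>i\<in>{1..m}. nc_eval scale (multilinear_ncpoly m lam)
      (a(i := commutator x (a i))))"
    unfolding nc_eval_multilinear by (rule sum.swap)
  finally show ?thesis .
qed

lemma bounded_sums_commutator_nc_image:
  assumes "y \<in> nc_image scale (multilinear_ncpoly m lam)"
  shows "bounded_sums (nc_image scale (multilinear_ncpoly m lam)) (\<lambda>x. commutator x y)"
proof -
  from assms obtain a where y: "y = nc_eval scale (multilinear_ncpoly m lam) a"
    by (auto simp: nc_image_def)
  show ?thesis unfolding y commutator_nc_eval_multilinear
    by (intro bounded_sums_sum bounded_sums_member) (auto simp: nc_image_def)
qed

lemma nc_image_subset_ideal:
  assumes "two_sided_ideal J" and comm: "\<And>x y. commutator x y \<in> J"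
    and lam: "(\<Sum>\<sigma> | \<sigma> permutes {1..m}. lam \<sigma>) = 0"
  shows "nc_image scale (multilinear_ncpoly m lam) \<subseteq> J"
proof
  interpret two_sided_ideal J by fact
  let ?P = "{\<sigma>. \<sigma> permutes {1..m}}" and ?w = "\<lambda>\<sigma>. map \<sigma> [1..<Suc m]"
  fix y assume "y \<in> nc_image scale (multilinear_ncpoly m lam)"
  then obtain a where y: "y = nc_eval scale (multilinear_ncpoly m lam) a"
    by (auto simp: nc_image_def)
  let ?p = "prod_list (map a [1..<Suc m])"
  \<comment> \<open>The coefficients sum to zero, so the subtracted term is zero. It allows every
    permuted word to be compared with the word in natural order.\<close>
  have "y = y - scale (\<Sum>\<sigma>\<in>?P. lam \<sigma>) ?p"
    using lam by (simp add: scale_zero_left)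
  also have "\<dots> = (\<Sum>\<sigma>\<in>?P. scale (lam \<sigma>) (prod_list (map a (?w \<sigma>)) - ?p))"
    by (simp only: y nc_eval_multilinear scale_sum_left scale_diff_right sum_subtractf)
  also have "\<dots> \<in> J"
  proof (rule sum)
    fix \<sigma> assume "\<sigma> \<in> ?P"
    then have "distinct (?w \<sigma>)" "set (?w \<sigma>) = set [1..<Suc m]"
      using permuted_word[of \<sigma> m] by (simp_all add: atLeastLessThanSuc_atLeastAtMost del: upt_Suc)
    then have "mset (?w \<sigma>) = mset [1..<Suc m]"
      using set_eq_iff_mset_eq_distinct distinct_upt by blast
    then have "mset (map a (?w \<sigma>)) = mset (map a [1..<Suc m])" by (simp only: mset_map)
    then have d: "prod_list (map a (?w \<sigma>)) - ?p \<in> J" by (rule prod_list_mset_cong[OF comm])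
    \<comment> \<open>\<open>two_sided_ideal\<close> provides closure under ring multiplication
      only; a scalar acts as left multiplication by \<open>scale c 1\<close>.\<close>
    have "scale c z = scale c 1 * z" for c z by (simp add: scale_mult_left)
    then show "scale (lam \<sigma>) (prod_list (map a (?w \<sigma>)) - ?p) \<in> J"
      using mult_left[OF d] by metis
  qed
  finally show "y \<in> J" .
qed

end

section \<open>The ideal \<open>J\<close> and the passage from \<open>1 \<in> J\<close> to a uniform
  number of summands\<close>

theorem theorem12:
  fixes scale :: "'k::{comm_ring,comm_monoid_mult} \<Rightarrow> 'r::{ring,monoid_mult} \<Rightarrow> 'r"
    and lam :: "(nat \<Rightarrow> nat) \<Rightarrow> 'k"
    and f :: "'k ncpoly"
    and m n :: nat
  assumes "unital_algebra scale"
    and "m \<ge> 1"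
    and "f = multilinear_ncpoly m lam"
    and "(\<Sum>\<sigma> | \<sigma> permutes {1..m}. lam \<sigma>) = 0"
    and "n > 1"
    and "group_closure (n_products (nc_image scale f) n) = UNIV"
  shows "\<exists>N::nat. N \<ge> 1 \<and> (\<forall>x::'r. \<exists>a :: nat \<Rightarrow> 'r.
    (\<forall>i\<in>{1..N}. a i \<in> n_products (nc_image scale f) n) \<and> x = (\<Sum>i=1..N. a i))"
proof -
  interpret unital_algebra scale by fact
  define F where "F = nc_image scale f"
  define B where "B = n_products F n"
  obtain k where n: "n = Suc k" and "k > 0" using \<open>n > 1\<close> by (cases n) auto
  have gen: "group_closure B = UNIV" using assms(6) by (simp add: B_def F_def)
  have F_comm: "bounded_sums F (\<lambda>x. commutator x y)" if "y \<in> F" for y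
    using that bounded_sums_commutator_nc_image by (simp add: F_def assms(3))
  have B_minus: "- b \<in> B" if "b \<in> B" for b
  proof -
    from that obtain y q where "b = y * q" "y \<in> F" "q \<in> n_products F k"
      unfolding B_def n by (rule n_products_SucE)
    moreover from this have "- y \<in> F"
      using minus_in_nc_image \<open>m \<ge> 1\<close> by (simp add: F_def assms(3))
    ultimately show ?thesis
      unfolding B_def n by (metis n_products_Cons mult_minus_left)
  qed
  have "0 \<in> F" using zero_in_nc_image \<open>m \<ge> 1\<close> by (simp add: F_def assms(3))
  have B_comm: "bounded_sums B (\<lambda>x. commutator x p)" for p
    by (rule bounded_sums_commutator[OF gen _ B_minus], unfold B_def)
      (rule bounded_sums_commutator_n_products[OF F_comm])

  define J where "J = {z. bounded_sums B (\<lambda>x. z * x)}"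
  interpret J: two_sided_ideal J
  proof
    show "0 \<in> J"
      unfolding J_def mem_Collect_eq mult_zero_left by (rule bounded_sums_zero)
    show "x - y \<in> J" if "x \<in> J" "y \<in> J" for x y
      using that unfolding J_def mem_Collect_eq left_diff_distrib
      by (rule bounded_sums_minus[OF _ _ B_minus])
    show "x * r \<in> J" if "x \<in> J" for x r
      using that unfolding J_def mem_Collect_eq mult.assoc by (rule bounded_sums_comp)
    show "r * x \<in> J" if "x \<in> J" for x r
    proof -
      have "bounded_sums B (\<lambda>y. x * (y * r))"
        using that unfolding J_def mem_Collect_eq by (rule bounded_sums_comp)
      moreover have "bounded_sums B (\<lambda>y. commutator (x * y) r)"
        by (rule bounded_sums_comp[OF B_comm])
      ultimately have "bounded_sums B (\<lambda>y. x * (y * r) - commutator (x * y) r)"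
        by (rule bounded_sums_minus[OF _ _ B_minus])
      moreover have "x * (y * r) - commutator (x * y) r = r * x * y" for y
        by (simp add: algebra_simps)
      ultimately show ?thesis by (simp add: J_def)
    qed
  qed
  have "commutator a b \<in> J" if a: "a \<in> F" and b: "b \<in> n_products F (n - 1)" for a b
  proof -
    \<comment> \<open>As \<open>b\<close> has \<open>n - 1\<close> factors, multiplying it by an
      element of \<open>F\<close> gives an element of \<open>B\<close>.\<close>
    have "bounded_sums B (\<lambda>x. b * commutator x a)"
      by (rule bounded_sums_image[OF F_comm[OF a]])
        (use b n_products_snoc in \<open>auto simp: B_def n algebra_simps\<close>)
    moreover have "bounded_sums B (\<lambda>x. commutator (b * x) a)"
      by (rule bounded_sums_comp[OF B_comm])
    ultimately have "bounded_sums B (\<lambda>x. b * commutator x a - commutator (b * x) a)"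
      by (rule bounded_sums_minus[OF _ _ B_minus])
    moreover have "b * commutator x a - commutator (b * x) a = commutator a b * x" for x
      by (simp add: algebra_simps)
    ultimately show ?thesis by (simp add: J_def)
  qed
  then have "commutator x y \<in> J" for x y
    using gen \<open>n > 1\<close> unfolding B_def by (rule J.commutators_in_ideal)
  then have "F \<subseteq> J"
    unfolding F_def assms(3) by (rule nc_image_subset_ideal[OF J.two_sided_ideal_axioms _ assms(4)])
  \<comment> \<open>The first factor of an element of \<open>B\<close> lies in \<open>F\<close>,
    hence in \<open>J\<close>.\<close>
  then have "B \<subseteq> J"
    unfolding B_def n by (auto elim!: n_products_SucE intro: J.mult_right)
  then have "group_closure B \<subseteq> J"
    by (intro group_closure_subset_closed J.zero J.diff)
  \<comment> \<open>For \<open>z = 1\<close> the condition defining \<open>J\<close> says that the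
    identity function has values in bounded sums, which is the claim in terms of lists.\<close>
  then have "1 \<in> J" using gen by auto
  then obtain N where
    N: "\<And>x. \<exists>ys. length ys = N \<and> set ys \<subseteq> B \<and> x = sum_list ys"
    by (auto simp: J_def bounded_sums_def)
  have "0 \<in> B"
  proof -
    \<comment> \<open>Any such \<open>q\<close> serves, since it is multiplied by 0 from the
      left.\<close>
    have "\<exists>q. q \<in> n_products F k"
      unfolding n_products_def using \<open>0 \<in> F\<close>
      by (intro exI[of _ "prod_list (replicate k 0)"]) (auto intro!: exI[of _ "replicate k 0"])
    then show ?thesis using n_products_Cons[OF \<open>0 \<in> F\<close>] by (auto simp: B_def n)
  qed
  \<comment> \<open>The extra zero summand only serves to make the number of summands positive.\<close>
  have "\<exists>a. (\<forall>i\<in>{1..Suc N}. a i \<in> B) \<and> x = (\<Sum>i=1..Suc N. a i)" for x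
  proof -
    from N[of x] obtain ys where ys: "length ys = N" "set ys \<subseteq> B" "x = sum_list ys" by blast
    let ?zs = "0 # ys"
    \<comment> \<open>List positions count from 0 and the summands of the statement from 1, hence
      the shift \<open>i - 1\<close>.\<close>
    have "\<forall>i\<in>{1..Suc N}. ?zs ! (i - 1) \<in> B"
    proof
      fix i assume "i \<in> {1..Suc N}"
      then have "?zs ! (i - 1) \<in> set ?zs" using ys(1) by (intro nth_mem) auto
      then show "?zs ! (i - 1) \<in> B" using ys(2) \<open>0 \<in> B\<close> by auto
    qed
    moreover have "x = (\<Sum>i=1..Suc N. ?zs ! (i - 1))"
    proof -
      have "(\<Sum>i=1..Suc N. ?zs ! (i - 1)) = (\<Sum>i=0..N. ?zs ! i)"
        using sum.shift_bounds_cl_Suc_ivl[of "\<lambda>i. ?zs ! (i - 1)" 0 N] by simp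
      also have "\<dots> = sum_list ?zs"
        by (simp add: sum_list_sum_nth ys(1) atLeastLessThanSuc_atLeastAtMost del: sum_list.Cons)
      finally show ?thesis using ys(3) by simp
    qed
    ultimately show ?thesis by (intro exI[of _ "\<lambda>i. ?zs ! (i - 1)"] conjI)
  qed
  then show ?thesis unfolding B_def F_def by (intro exI[of _ "Suc N"]) auto
qed

end
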